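(* Let $(X_t)_{t\ge1}$ be a sequence of random variables such that, for constants $\mu,\sigma^2$ and all $t\ge 1$, $X_t\in[0,1]$, $\mathbb{E}_{t-1}X_t=\mu$ and $\mathbb{V}_{t-1}X_t=\sigma^2$. Let $\alpha\in(0,1)$. For any $[0,1)$-valued predictable sequence $(\lambda_i)_{i\ge1}$ and any $[0,1]$-valued predictable sequences $(\widehat\mu_i)_{i\ge1}$ and $(\widehat\sigma_i)_{i\ge1}$, the sequence of open intervals $$\left(D_t-E_t-R_{t,\alpha/2},\; D_t-E_t+R_{t,\alpha/2}\right),\quad t\ge1,$$ is a $1-\alpha$ confidence sequence for $\sigma^2$, where $$D_t=\frac{\sum_{i\le t}\lambda_i(X_i-\widehat\mu_i)^2}{\sum_{i\le t}\lambda_i},\qquad E_t=\frac{\sum_{i\le t}\lambda_i(\widehat\mu_i-\mu)^2}{\sum_{i\le t}\lambda_i},$$ $$R_{t,\delta}=\frac{\log(1/\delta)+\sum_{i\le t}\psi_E(\lambda_i)\left((X_i-\widehat\mu_i)^2-\widehat\sigma_i^2\right)^2}{\sum_{i\le t}\lambda_i}.$$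
   Context: All random variables live on a common probability space with probability $\mathbb{P}$. $\mathcal{F}_t=\sigma(X_1,\dots,X_t)$ is the canonical filtration, with $\mathcal{F}_0$ trivial; $\mathbb{E}_t[\cdot]=\mathbb{E}[\cdot\mid\mathcal{F}_t]$ and $\mathbb{V}_t[\cdot]=\mathbb{V}[\cdot\mid\mathcal{F}_t]$. Relations between random variables hold almost surely. A sequence $(M_i)_{i\ge1}$ is predictable if $M_i$ is $\mathcal{F}_{i-1}$-measurable for all $i\ge1$. A sequence of random sets $(C_t)_{t\ge1}$ is a $1-\alpha$ confidence sequence for $\theta$ if $\mathbb{P}(\forall t\ge1:\theta\in C_t)\ge1-\alpha$. For $\lambda\in[0,1)$, $\psi_E(\lambda)=-\log(1-\lambda)-\lambda$. Convention: at times $t$ with $\sum_{i\le t}\lambda_i=0$ the interval is taken to be all of $\mathbb{R}$. *)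

theory Defs
  imports "HOL-Probability.Probability"
begin

(* The process is indexed from 1, so X 0 is ignored, and for t = 0 the generator
   is empty: canonical_filtration M X 0 is the trivial sigma-algebra. *)
definition canonical_filtration :: "'a measure \<Rightarrow> (nat \<Rightarrow> 'a \<Rightarrow> real) \<Rightarrow> nat \<Rightarrow> 'a measure" where
  "canonical_filtration M X t =
     sigma (space M) {X i -` B \<inter> space M | i B. i \<in> {1..t} \<and> B \<in> sets borel}"

definition predictable :: "(nat \<Rightarrow> 'a measure) \<Rightarrow> (nat \<Rightarrow> 'a \<Rightarrow> real) \<Rightarrow> bool" where
  "predictable F Z \<longleftrightarrow> (\<forall>i\<ge>1. Z i \<in> borel_measurable (F (i - 1)))"

definition real_cond_var :: "'a measure \<Rightarrow> 'a measure \<Rightarrow> ('a \<Rightarrow> real) \<Rightarrow> 'a \<Rightarrow> real" where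
  "real_cond_var M F Y = real_cond_exp M F (\<lambda>\<omega>. (Y \<omega> - real_cond_exp M F Y \<omega>)\<^sup>2)"

(* For \<alpha> < 1 the inequality also forces the coverage event to be measurable, since
   measure is 0 outside sets M. *)
definition confidence_sequence ::
    "'a measure \<Rightarrow> real \<Rightarrow> real \<Rightarrow> (nat \<Rightarrow> 'a \<Rightarrow> real set) \<Rightarrow> bool" where
  "confidence_sequence M \<alpha> \<theta> C \<longleftrightarrow>
     measure M {\<omega> \<in> space M. \<forall>t\<ge>1. \<theta> \<in> C t \<omega>} \<ge> 1 - \<alpha>"

definition psi_E :: "real \<Rightarrow> real" where
  "psi_E l = - ln (1 - l) - l"

definition D_stat :: "(nat \<Rightarrow> 'a \<Rightarrow> real) \<Rightarrow> (nat \<Rightarrow> 'a \<Rightarrow> real) \<Rightarrow> (nat \<Rightarrow> 'a \<Rightarrow> real) \<Rightarrow>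
    nat \<Rightarrow> 'a \<Rightarrow> real" where
  "D_stat X lam muh t \<omega> =
     (\<Sum>i=1..t. lam i \<omega> * (X i \<omega> - muh i \<omega>)\<^sup>2) / (\<Sum>i=1..t. lam i \<omega>)"

definition E_stat :: "real \<Rightarrow> (nat \<Rightarrow> 'a \<Rightarrow> real) \<Rightarrow> (nat \<Rightarrow> 'a \<Rightarrow> real) \<Rightarrow>
    nat \<Rightarrow> 'a \<Rightarrow> real" where
  "E_stat \<mu> lam muh t \<omega> =
     (\<Sum>i=1..t. lam i \<omega> * (muh i \<omega> - \<mu>)\<^sup>2) / (\<Sum>i=1..t. lam i \<omega>)"

definition R_stat :: "(nat \<Rightarrow> 'a \<Rightarrow> real) \<Rightarrow> (nat \<Rightarrow> 'a \<Rightarrow> real) \<Rightarrow> (nat \<Rightarrow> 'a \<Rightarrow> real) \<Rightarrow>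
    (nat \<Rightarrow> 'a \<Rightarrow> real) \<Rightarrow> real \<Rightarrow> nat \<Rightarrow> 'a \<Rightarrow> real" where
  "R_stat X lam muh sigh \<delta> t \<omega> =
     (ln (1 / \<delta>) +
        (\<Sum>i=1..t. psi_E (lam i \<omega>) * ((X i \<omega> - muh i \<omega>)\<^sup>2 - (sigh i \<omega>)\<^sup>2)\<^sup>2))
     / (\<Sum>i=1..t. lam i \<omega>)"

(* As long as all weights vanish the quotients are undefined, and the interval is
   the whole line by convention. *)
definition variance_interval :: "real \<Rightarrow> real \<Rightarrow> (nat \<Rightarrow> 'a \<Rightarrow> real) \<Rightarrow> (nat \<Rightarrow> 'a \<Rightarrow> real) \<Rightarrow>
    (nat \<Rightarrow> 'a \<Rightarrow> real) \<Rightarrow> (nat \<Rightarrow> 'a \<Rightarrow> real) \<Rightarrow> nat \<Rightarrow> 'a \<Rightarrow> real set" where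
  "variance_interval \<alpha> \<mu> X lam muh sigh t \<omega> =
     (if (\<Sum>i=1..t. lam i \<omega>) = 0 then UNIV
      else {D_stat X lam muh t \<omega> - E_stat \<mu> lam muh t \<omega> - R_stat X lam muh sigh (\<alpha> / 2) t \<omega>
            <..<
            D_stat X lam muh t \<omega> - E_stat \<mu> lam muh t \<omega> + R_stat X lam muh sigh (\<alpha> / 2) t \<omega>})"

end

theory Submission
  imports Defs
begin

text \<open>
  The squared errors \<open>Y i = (X i - muh i)\<^sup>2\<close> lie in \<open>[0, 1]\<close>. Because \<open>muh i\<close> is known one step in
  advance, expanding the square around \<open>\<mu>\<close> shows that, given the past, \<open>Y i\<close> has mean
  \<open>m i = \<sigma>\<^sup>2 + (muh i - \<mu>)\<^sup>2\<close> (\<open>real_cond_exp_square_deviation\<close>). Multiplying through by the sum of the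
  weights, when it is positive, \<open>\<sigma>\<^sup>2\<close> belongs to the interval at time \<open>t\<close> exactly when the weighted martingale
  \<open>\<Sum>i\<le>t. lam i * (Y i - m i)\<close> is in absolute value smaller than
  \<open>ln (2 / \<alpha>) + (\<Sum>i\<le>t. psi_E (lam i) * (Y i - (sigh i)\<^sup>2)\<^sup>2)\<close> (\<open>mem_variance_interval_iff\<close>). So the claim
  is a time-uniform empirical Bernstein inequality for a bounded process with predictable
  conditional means (\<open>empirical_bernstein_two_sided\<close>).

  That inequality is a maximal inequality for an exponential supermartingale. Fan's inequality
  \<open>exp (l * x - psi_E l * x\<^sup>2) \<le> 1 + l * x\<close>, applied to the deviation \<open>x = Y i - c i\<close> from a predictable
  guess \<open>c i\<close> of \<open>Y i\<close>, turns the exponential into something linear in \<open>Y i\<close>, whose conditional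
  expectation is known. The factor left over is \<open>(1 + u) * exp (- u)\<close> with \<open>u = l i * (m i - c i)\<close>, and it
  is at most 1 whatever the quality of the guess (\<open>empirical_bernstein_step\<close>). Hence
  \<open>exp (\<Sum>i\<le>t. l i * (Y i - m i) - psi_E (l i) * (Y i - c i)\<^sup>2)\<close> is a supermartingale started at 1, and by
  Ville's inequality it ever reaches \<open>1 / \<delta>\<close> with probability at most \<open>\<delta>\<close>. Replacing \<open>Y\<close>, \<open>m\<close>, \<open>c\<close>
  by \<open>1 - Y\<close>, \<open>1 - m\<close>, \<open>1 - c\<close> changes the sign of the martingale and keeps the quadratic penalty, which
  gives the lower tail; a union bound with \<open>\<delta> = \<alpha> / 2\<close> concludes.
\<close>

section \<open>Fan's inequality\<close>

lemma psi_E_nonneg: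
  assumes "0 \<le> l" "l < 1"
  shows "0 \<le> psi_E l"
  using ln_le_minus_one[of "1 - l"] assms by (simp add: psi_E_def)

lemma borel_measurable_psi_E [measurable]: "psi_E \<in> borel_measurable borel"
proof -
  have "(\<lambda>l. - ln (1 - l) - l) \<in> borel_measurable (borel :: real measure)"
    by measurable
  then show ?thesis
    by (simp add: psi_E_def[abs_def])
qed

text \<open>
  After taking logarithms both sides agree at \<open>l = 0\<close>, and the derivative of the difference in \<open>l\<close> is
  \<open>l * x\<^sup>2 * (1 / (1 - l) - 1 / (1 + l * x))\<close>, which is nonnegative because \<open>- l \<le> l * x\<close>. The function
  \<open>psi_E\<close> is what makes the inequality tight at \<open>x = -1\<close>.
\<close>

lemma fan_inequality:
  assumes l: "0 \<le> l" "l < 1" and x: "-1 \<le> x"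
  shows "exp (l * x - psi_E l * x\<^sup>2) \<le> 1 + l * x"
proof -
  have pos: "0 < 1 + u * x" if "0 \<le> u" "u < 1" for u
    using mult_left_mono[OF x that(1)] that by simp
  define h where "h u = ln (1 + u * x) - u * x + psi_E u * x\<^sup>2" for u
  have "h 0 \<le> h l"
  proof (rule DERIV_nonneg_imp_nondecreasing[OF l(1)])
    fix u assume u: "0 \<le> u" "u \<le> l"
    then have u1: "u < 1"
      using l by simp
    note p = pos[OF u(1) u1]
    have "(h has_real_derivative (x / (1 + u * x) - x + (1 / (1 - u) - 1) * x\<^sup>2)) (at u)"
      unfolding h_def psi_E_def using p u1 by (auto intro!: derivative_eq_intros simp: field_simps)
    moreover have "x / (1 + u * x) - x + (1 / (1 - u) - 1) * x\<^sup>2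
        = u * x\<^sup>2 * (1 / (1 - u) - 1 / (1 + u * x))"
      using p u1 by (simp add: field_simps power2_eq_square)
    moreover have "1 / (1 + u * x) \<le> 1 / (1 - u)"
      using p u1 mult_left_mono[OF x u(1)] by (intro divide_left_mono) auto
    ultimately show "\<exists>y. (h has_real_derivative y) (at u) \<and> 0 \<le> y"
      using u by (intro exI[of _ "u * x\<^sup>2 * (1 / (1 - u) - 1 / (1 + u * x))"]) auto
  qed
  then have "l * x - psi_E l * x\<^sup>2 \<le> ln (1 + l * x)"
    by (simp add: h_def psi_E_def)
  then show ?thesis
    using pos[OF l] by (simp add: ln_ge_iff)
qed

section \<open>Ville's maximal inequality\<close>

locale filtered_prob_space = prob_space M + filtration "space M" F
  for M :: "'a measure" and F :: "nat \<Rightarrow> 'a measure" +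
  assumes sets_F_subset: "sets (F n) \<subseteq> sets M"
begin

lemma subalgebra_F: "subalgebra M (F n)"
  by (simp add: subalgebra_def space_F sets_F_subset)

lemma measurable_F_mono: "f \<in> measurable (F i) N \<Longrightarrow> i \<le> j \<Longrightarrow> f \<in> measurable (F j) N"
  using sets_F_mono[of i j] by (auto simp: measurable_def space_F)

lemma measurable_F_M: "f \<in> measurable (F i) N \<Longrightarrow> f \<in> measurable M N"
  using measurable_from_subalg[OF subalgebra_F] .

lemma finite_measure_subalgebra_F: "finite_measure_subalgebra M (F n)"
  by unfold_locales (rule subalgebra_F)

text \<open>
  Stop the process on first reaching \<open>a\<close>. Up to time \<open>n\<close>, the paths that have reached \<open>a\<close> contribute at
  least \<open>a\<close> each, the others contribute their current value, and the total cannot exceed the initial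
  expectation: this is \<open>step\<close> in the proof. Dropping the nonnegative second contribution and letting
  \<open>n\<close> grow gives the bound for the whole time axis. The supermartingale property is expressed by
  integrals over events of \<open>F n\<close>, the form in which both this argument and its application need it.
\<close>

lemma ville_maximal_inequality:
  fixes S :: "nat \<Rightarrow> 'a \<Rightarrow> real" and a :: real
  assumes adapted: "\<And>n. S n \<in> borel_measurable (F n)"
    and int: "\<And>n. integrable M (S n)"
    and nonneg: "\<And>n. AE x in M. 0 \<le> S n x"
    and supermart: "\<And>n A. A \<in> sets (F n) \<Longrightarrow> (\<integral>x\<in>A. S (Suc n) x \<partial>M) \<le> (\<integral>x\<in>A. S n x \<partial>M)"
  shows "a * prob {x \<in> space M. \<exists>n. a \<le> S n x} \<le> expectation (S 0)"
proof -
  define A where "A n = {x \<in> space M. \<exists>k\<le>n. a \<le> S k x}" for n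
  have A_F: "A n \<in> sets (F n)" for n
  proof -
    have [measurable]: "S k \<in> borel_measurable (F n)" if "k \<in> {..n}" for k
      using measurable_F_mono[OF adapted] that by simp
    have "A n = (\<Union>k\<in>{..n}. {x \<in> space (F n). a \<le> S k x})"
      by (auto simp: A_def space_F)
    also have "\<dots> \<in> sets (F n)"
      by measurable
    finally show ?thesis .
  qed
  have A_M [measurable]: "A n \<in> sets M" for n
    using A_F sets_F_subset by blast
  have S_M [measurable]: "S n \<in> borel_measurable M" for n
    using measurable_F_M[OF adapted] .
  have si: "set_integrable M B (S n)" if "B \<in> sets M" for B n
    unfolding set_integrable_def using integrable_mult_indicator[OF that int] by simp
  have sc: "set_integrable M B (\<lambda>x. a)" if "B \<in> sets M" for B
    unfolding set_integrable_def using integrable_mult_indicator[OF that integrable_const[of a]] by simp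
  have step: "a * prob (A n) + (\<integral>x\<in>space M - A n. S n x \<partial>M) \<le> expectation (S 0)" for n
  proof (induction n)
    case 0
    have *: "a * prob (A 0) \<le> (\<integral>x\<in>A 0. S 0 x \<partial>M)"
    proof -
      have "a * prob (A 0) = (\<integral>x\<in>A 0. a \<partial>M)"
        by (simp add: set_lebesgue_integral_def)
      also have "\<dots> \<le> (\<integral>x\<in>A 0. S 0 x \<partial>M)"
        by (rule set_integral_mono) (auto simp: si sc A_def)
      finally show ?thesis .
    qed
    have "(\<integral>x\<in>A 0. S 0 x \<partial>M) + (\<integral>x\<in>space M - A 0. S 0 x \<partial>M)
        = (\<integral>x\<in>A 0 \<union> (space M - A 0). S 0 x \<partial>M)"
      by (rule set_integral_Un[symmetric]) (auto intro: si)
    also have "A 0 \<union> (space M - A 0) = space M"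
      by (auto simp: A_def)
    finally show ?case
      using * set_integral_space[OF int] by simp
  next
    case (Suc n)
    \<comment> \<open>The paths that reach the level at time \<open>Suc n\<close> for the first time.\<close>
    define B where "B = A (Suc n) - A n"
    have [measurable]: "B \<in> sets M"
      by (simp add: B_def)
    have sub: "A n \<subseteq> A (Suc n)"
      by (auto simp: A_def) (metis le_SucI)
    have "prob (A (Suc n)) = prob (A n) + prob B"
      using finite_measure_Union[of "A n" B] sub by (simp add: B_def Un_absorb1)
    moreover have "a * prob B \<le> (\<integral>x\<in>B. S (Suc n) x \<partial>M)"
    proof -
      have "a * prob B = (\<integral>x\<in>B. a \<partial>M)"
        by (simp add: set_lebesgue_integral_def)
      also have "\<dots> \<le> (\<integral>x\<in>B. S (Suc n) x \<partial>M)"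
      proof (rule set_integral_mono)
        fix x assume "x \<in> B"
        then show "a \<le> S (Suc n) x"
          by (auto simp: B_def A_def le_Suc_eq)
      qed (auto simp: si sc)
      finally show ?thesis .
    qed
    moreover have "(\<integral>x\<in>B. S (Suc n) x \<partial>M) + (\<integral>x\<in>space M - A (Suc n). S (Suc n) x \<partial>M)
        = (\<integral>x\<in>space M - A n. S (Suc n) x \<partial>M)"
    proof -
      have "space M - A n = B \<union> (space M - A (Suc n))"
        using sub by (auto simp: B_def A_def)
      then show ?thesis
        by (simp only:) (rule set_integral_Un[symmetric], auto simp: B_def intro: si)
    qed
    moreover have "(\<integral>x\<in>space M - A n. S (Suc n) x \<partial>M) \<le> (\<integral>x\<in>space M - A n. S n x \<partial>M)"
      using A_F[of n] sets.compl_sets[of "A n" "F n"] by (intro supermart) (simp add: space_F)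
    ultimately show ?case
      using Suc.IH by (simp add: distrib_left)
  qed
  have bound: "a * prob (A n) \<le> expectation (S 0)" for n
  proof -
    have "0 \<le> (\<integral>x\<in>space M - A n. S n x \<partial>M)"
      unfolding set_lebesgue_integral_def using nonneg[of n]
      by (intro integral_nonneg_AE) (auto simp: indicator_def)
    then show ?thesis
      using step[of n] by simp
  qed
  have "(\<lambda>n. prob (A n)) \<longlonglongrightarrow> prob (\<Union>n. A n)"
    by (rule finite_Lim_measure_incseq) (auto simp: incseq_def A_def intro: order_trans)
  then have "(\<lambda>n. a * prob (A n)) \<longlonglongrightarrow> a * prob (\<Union>n. A n)"
    by (rule tendsto_mult_left)
  moreover have "(\<Union>n. A n) = {x \<in> space M. \<exists>n. a \<le> S n x}"
    by (auto simp: A_def)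
  ultimately show ?thesis
    using bound by (auto intro: LIMSEQ_le_const2)
qed

end

section \<open>Conditioning on the past\<close>

context finite_measure_subalgebra
begin

text \<open>
  The bias-variance decomposition given \<open>F\<close>: as \<open>h\<close> is measurable with respect to \<open>F\<close>, the cross term
  of \<open>((X - \<mu>) + (\<mu> - h))\<^sup>2\<close> has conditional expectation zero.
\<close>

lemma real_cond_exp_square_deviation:
  assumes [measurable]: "X \<in> borel_measurable M" and X: "AE x in M. \<bar>X x\<bar> \<le> K"
    and h_F: "h \<in> borel_measurable F" and h: "AE x in M. \<bar>h x\<bar> \<le> K"
    and mean: "AE x in M. real_cond_exp M F X x = \<mu>"
  shows "AE x in M. real_cond_exp M F (\<lambda>x. (X x - h x)\<^sup>2) x
      = real_cond_var M F X x + (h x - \<mu>)\<^sup>2"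
proof -
  have h_M [measurable]: "h \<in> borel_measurable M"
    using measurable_from_subalg[OF subalg h_F] .
  note h_F [measurable]
  define Z where "Z x = (X x - \<mu>)\<^sup>2" for x
  define V where "V x = 2 * (\<mu> - h x)" for x
  have [measurable]: "Z \<in> borel_measurable M" "V \<in> borel_measurable F" "V \<in> borel_measurable M"
    by (simp_all add: Z_def[abs_def] V_def[abs_def])
  have iX: "integrable M X"
    using X by (intro integrable_const_bound[of X K]) auto
  have iZ: "integrable M Z"
  proof (rule integrable_const_bound)
    show "AE x in M. norm (Z x) \<le> (K + \<bar>\<mu>\<bar>)\<^sup>2"
      using X
    proof eventually_elim
      case (elim x)
      then have "\<bar>X x - \<mu>\<bar> \<le> \<bar>K + \<bar>\<mu>\<bar>\<bar>" by linarith
      then show ?case by (simp add: Z_def abs_le_square_iff)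
    qed
  qed simp
  have iVX: "integrable M (\<lambda>x. V x * X x)"
  proof (rule integrable_const_bound)
    show "AE x in M. norm (V x * X x) \<le> (2 * (K + \<bar>\<mu>\<bar>)) * K"
      using X h
    proof eventually_elim
      case (elim x)
      then have "0 \<le> K" and "\<bar>\<mu> - h x\<bar> \<le> K + \<bar>\<mu>\<bar>" by linarith+
      then show ?case
        unfolding real_norm_def abs_mult V_def using elim by (intro mult_mono) auto
    qed
  qed simp
  have iV: "integrable M (\<lambda>x. (h x)\<^sup>2 - \<mu>\<^sup>2)"
  proof (rule integrable_const_bound)
    show "AE x in M. norm ((h x)\<^sup>2 - \<mu>\<^sup>2) \<le> K\<^sup>2 + \<mu>\<^sup>2"
      using h
    proof eventually_elim
      case (elim x)
      then have "(h x)\<^sup>2 \<le> K\<^sup>2" using abs_le_square_iff[of "h x" K] by linarith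
      then show ?case
        unfolding real_norm_def using zero_le_power2[of "h x"] zero_le_power2[of \<mu>] by linarith
    qed
  qed simp
  \<comment> \<open>Writing the cross term through \<open>X\<close> itself leaves one product \<open>V x * X x\<close> to condition, plus a part
    that is already measurable with respect to \<open>F\<close>.\<close>
  have split: "(\<lambda>x. (X x - h x)\<^sup>2) = (\<lambda>x. Z x + (V x * X x + ((h x)\<^sup>2 - \<mu>\<^sup>2)))"
    by (auto simp: Z_def V_def power2_eq_square algebra_simps)
  have "AE x in M. real_cond_exp M F (\<lambda>x. (X x - h x)\<^sup>2) x
      = real_cond_exp M F Z x + real_cond_exp M F (\<lambda>x. V x * X x + ((h x)\<^sup>2 - \<mu>\<^sup>2)) x"
    unfolding split by (intro real_cond_exp_add iZ Bochner_Integration.integrable_add iVX iV)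
  moreover have "AE x in M. real_cond_exp M F (\<lambda>x. V x * X x + ((h x)\<^sup>2 - \<mu>\<^sup>2)) x
      = real_cond_exp M F (\<lambda>x. V x * X x) x + real_cond_exp M F (\<lambda>x. (h x)\<^sup>2 - \<mu>\<^sup>2) x"
    by (intro real_cond_exp_add iVX iV)
  moreover have "AE x in M. real_cond_exp M F (\<lambda>x. V x * X x) x = V x * real_cond_exp M F X x"
    by (intro real_cond_exp_mult iVX) simp_all
  moreover have "AE x in M. real_cond_exp M F (\<lambda>x. (h x)\<^sup>2 - \<mu>\<^sup>2) x = (h x)\<^sup>2 - \<mu>\<^sup>2"
    by (intro real_cond_exp_F_meas iV) simp
  moreover have "AE x in M. real_cond_var M F X x = real_cond_exp M F Z x"
    unfolding real_cond_var_def using mean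
    by (intro real_cond_exp_cong) (auto simp: Z_def)
  ultimately show ?thesis
    using mean by eventually_elim (simp add: V_def power2_eq_square algebra_simps)
qed

text \<open>
  One step of the supermartingale, tested against a weight \<open>G\<close> known in advance. Splitting
  \<open>Y - m = (Y - c) - (m - c)\<close> separates the random part, to which Fan's inequality applies since
  \<open>-1 \<le> Y - c\<close>, from the factor \<open>exp (- l * (m - c))\<close> known in advance. Taking conditional
  expectations of \<open>1 + l * (Y - c)\<close> replaces \<open>Y\<close> by \<open>m\<close>, and \<open>(1 + u) * exp (- u) \<le> 1\<close> closes the
  estimate.
\<close>

lemma empirical_bernstein_step:
  assumes Y_M: "Y \<in> borel_measurable M" and Y: "AE x in M. Y x \<in> {0..1}"
    and mean: "AE x in M. real_cond_exp M F Y x = m x" and m_F: "m \<in> borel_measurable F"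
    and c_F: "c \<in> borel_measurable F" and c: "AE x in M. c x \<in> {0..1}"
    and l_F: "l \<in> borel_measurable F" and l: "AE x in M. l x \<in> {0..<1}"
    and G_F: "G \<in> borel_measurable F" and G: "AE x in M. G x \<in> {0..K}"
  shows "(\<integral>x. G x * exp (l x * (Y x - m x) - psi_E (l x) * (Y x - c x)\<^sup>2) \<partial>M) \<le> (\<integral>x. G x \<partial>M)"
proof -
  note [measurable] = Y_M m_F c_F l_F G_F
  note [measurable] = m_F[THEN measurable_from_subalg[OF subalg]]
    c_F[THEN measurable_from_subalg[OF subalg]]
    l_F[THEN measurable_from_subalg[OF subalg]]
    G_F[THEN measurable_from_subalg[OF subalg]]
  define W where "W x = G x * exp (- (l x * (m x - c x)))" for x
  have [measurable]: "W \<in> borel_measurable F" "W \<in> borel_measurable M"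
    by (simp_all add: W_def[abs_def])
  have iY: "integrable M Y"
    using Y by (intro integrable_const_bound[of Y 1]) auto
  have m: "AE x in M. m x \<in> {0..1}"
  proof -
    have "AE x in M. real_cond_exp M F Y x \<ge> 0" "AE x in M. real_cond_exp M F Y x \<le> 1"
      using Y by (intro real_cond_exp_ge_c real_cond_exp_le_c iY; force)+
    then show ?thesis
      using mean by eventually_elim simp
  qed
  have W: "AE x in M. W x \<in> {0..K * exp 1}"
    using m c l G
  proof eventually_elim
    case (elim x)
    then have "l x * (c x - m x) \<le> l x * 1"
      by (intro mult_left_mono) auto
    with elim have "exp (- (l x * (m x - c x))) \<le> exp 1"
      by (simp add: algebra_simps)
    then have "W x \<le> K * exp 1"
      unfolding W_def using elim by (intro mult_mono) auto
    then show ?case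
      using elim by (simp add: W_def)
  qed
  have iWl: "integrable M (\<lambda>x. (W x * l x) * Z x)"
    if [measurable]: "Z \<in> borel_measurable M" and Z: "AE x in M. Z x \<in> {0..1}" for Z
  proof (rule integrable_const_bound)
    show "AE x in M. norm (W x * l x * Z x) \<le> K * exp 1 * 1 * 1"
      using W l Z
    proof eventually_elim
      case (elim x)
      then show ?case
        unfolding real_norm_def abs_mult by (intro mult_mono) auto
    qed
  qed simp
  have iW: "integrable M W"
    using W by (intro integrable_const_bound[of W "K * exp 1"]) auto
  have iG: "integrable M G"
    using G by (intro integrable_const_bound[of G K]) auto
  have cond: "(\<integral>x. (W x * l x) * Y x \<partial>M) = (\<integral>x. (W x * l x) * m x \<partial>M)"
  proof -
    have "(\<integral>x. (W x * l x) * Y x \<partial>M) = (\<integral>x. (W x * l x) * real_cond_exp M F Y x \<partial>M)"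
      by (rule real_cond_exp_intg(2)[symmetric]) (auto intro: iWl Y)
    also have "\<dots> = (\<integral>x. (W x * l x) * m x \<partial>M)"
      using mean by (intro integral_cong_AE) auto
    finally show ?thesis .
  qed
  have "(\<integral>x. G x * exp (l x * (Y x - m x) - psi_E (l x) * (Y x - c x)\<^sup>2) \<partial>M)
      \<le> (\<integral>x. W x + (W x * l x) * Y x - (W x * l x) * c x \<partial>M)"
  proof (rule integral_mono_AE')
    show "integrable M (\<lambda>x. W x + (W x * l x) * Y x - (W x * l x) * c x)"
      by (intro Bochner_Integration.integrable_add Bochner_Integration.integrable_diff iW iWl c Y) auto
    show "AE x in M. G x * exp (l x * (Y x - m x) - psi_E (l x) * (Y x - c x)\<^sup>2)
        \<le> W x + (W x * l x) * Y x - (W x * l x) * c x"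
      using Y c l G W
    proof eventually_elim
      case (elim x)
      have "G x * exp (l x * (Y x - m x) - psi_E (l x) * (Y x - c x)\<^sup>2)
          = W x * exp (l x * (Y x - c x) - psi_E (l x) * (Y x - c x)\<^sup>2)"
        by (simp add: W_def mult.assoc flip: exp_add) (simp add: algebra_simps)
      also have "\<dots> \<le> W x * (1 + l x * (Y x - c x))"
        using elim by (intro mult_left_mono fan_inequality) auto
      finally show ?case
        by (simp add: algebra_simps)
    qed
    show "AE x in M. 0 \<le> W x + (W x * l x) * Y x - (W x * l x) * c x"
      using Y c l W
    proof eventually_elim
      case (elim x)
      have "l x * (c x - Y x) \<le> l x * 1"
        using elim by (intro mult_left_mono) auto
      with elim have "l x * (c x - Y x) \<le> 1"
        by simp
      then have "0 \<le> W x * (1 + l x * (Y x - c x))"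
        using elim by (intro mult_nonneg_nonneg) (auto simp: algebra_simps)
      then show ?case
        by (simp add: algebra_simps)
    qed
  qed
  also have "\<dots> = (\<integral>x. W x \<partial>M) + (\<integral>x. (W x * l x) * m x \<partial>M) - (\<integral>x. (W x * l x) * c x \<partial>M)"
    using iW iWl[OF _ Y] iWl[OF _ c] cond by simp
  also have "\<dots> = (\<integral>x. W x + (W x * l x) * m x - (W x * l x) * c x \<partial>M)"
    using iW iWl[OF _ m] iWl[OF _ c] by simp
  also have "\<dots> \<le> (\<integral>x. G x \<partial>M)"
  proof (rule integral_mono_AE)
    show "AE x in M. W x + (W x * l x) * m x - (W x * l x) * c x \<le> G x"
      using G
    proof eventually_elim
      case (elim x)
      define u where "u = l x * (m x - c x)"
      have "W x + (W x * l x) * m x - (W x * l x) * c x = G x * ((1 + u) * exp (- u))"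
        by (simp add: W_def u_def algebra_simps)
      also have "(1 + u) * exp (- u) \<le> exp u * exp (- u)"
        by (intro mult_right_mono exp_ge_add_one_self) simp
      finally show ?case
        using elim by (simp add: exp_minus mult_left_mono)
    qed
  qed (auto intro!: Bochner_Integration.integrable_add Bochner_Integration.integrable_diff iW iWl c m iG)
  finally show ?thesis .
qed

end

section \<open>A time-uniform empirical Bernstein inequality\<close>

context filtered_prob_space
begin

text \<open>
  Ville's inequality for the exponential process \<open>S\<close>, whose logarithm is the difference of the two
  sides. Every increment of \<open>ln (S n)\<close> is at most 1, since the weights and the deviations are at most
  1 and the penalty is nonnegative; this makes \<open>S n\<close> integrable. At time 0 the sums are empty and
  \<open>S 0 = 1\<close>.
\<close>

lemma empirical_bernstein_upper:
  fixes Y m c l :: "nat \<Rightarrow> 'a \<Rightarrow> real"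
  assumes Y_F: "\<And>i. i \<ge> 1 \<Longrightarrow> Y i \<in> borel_measurable (F i)"
    and Y: "\<And>i. i \<ge> 1 \<Longrightarrow> AE x in M. Y i x \<in> {0..1}"
    and mean: "\<And>i. i \<ge> 1 \<Longrightarrow> AE x in M. real_cond_exp M (F (i - 1)) (Y i) x = m i x"
    and m_F: "predictable F m"
    and c_F: "predictable F c" and c: "\<And>i. i \<ge> 1 \<Longrightarrow> AE x in M. c i x \<in> {0..1}"
    and l_F: "predictable F l" and l: "\<And>i. i \<ge> 1 \<Longrightarrow> AE x in M. l i x \<in> {0..<1}"
    and \<delta>: "0 < \<delta>"
  shows "prob {x \<in> space M. \<exists>t. ln (1 / \<delta>) + (\<Sum>i=1..t. psi_E (l i x) * (Y i x - c i x)\<^sup>2)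
      \<le> (\<Sum>i=1..t. l i x * (Y i x - m i x))} \<le> \<delta>"
proof -
  define g where "g i x = l i x * (Y i x - m i x) - psi_E (l i x) * (Y i x - c i x)\<^sup>2" for i x
  define S where "S n x = exp (\<Sum>i=1..n. g i x)" for n x
  have pred: "m i \<in> borel_measurable (F (i - 1))" "c i \<in> borel_measurable (F (i - 1))"
    "l i \<in> borel_measurable (F (i - 1))" if "i \<ge> 1" for i
    using m_F c_F l_F that by (auto simp: predictable_def)
  have g_F: "g i \<in> borel_measurable (F i)" if "i \<ge> 1" for i
  proof -
    have [measurable]: "Y i \<in> borel_measurable (F i)" "m i \<in> borel_measurable (F i)"
      "c i \<in> borel_measurable (F i)" "l i \<in> borel_measurable (F i)"
      using Y_F[OF that] pred[OF that, THEN measurable_F_mono] by auto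
    show ?thesis
      by (simp add: g_def[abs_def])
  qed
  have S_F: "S n \<in> borel_measurable (F n)" for n
  proof -
    have [measurable]: "g i \<in> borel_measurable (F n)" if "i \<in> {1..n}" for i
      using measurable_F_mono[OF g_F] that by simp
    show ?thesis
      unfolding S_def[abs_def] by measurable
  qed
  have g_le: "AE x in M. g i x \<le> 1" if i: "i \<ge> 1" for i
  proof -
    interpret finite_measure_subalgebra M "F (i - 1)"
      by (rule finite_measure_subalgebra_F)
    have "integrable M (Y i)"
      using Y[OF i] measurable_F_M[OF Y_F[OF i]] by (intro integrable_const_bound[of _ 1]) auto
    then have "AE x in M. 0 \<le> real_cond_exp M (F (i - 1)) (Y i) x"
      using Y[OF i] by (intro real_cond_exp_ge_c) auto
    then show ?thesis
      using mean[OF i] Y[OF i] l[OF i]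
    proof eventually_elim
      case (elim x)
      have "l i x * (Y i x - m i x) \<le> l i x * 1"
        using elim by (intro mult_left_mono) auto
      moreover have "0 \<le> psi_E (l i x) * (Y i x - c i x)\<^sup>2"
        using elim by (intro mult_nonneg_nonneg psi_E_nonneg) auto
      ultimately show ?case
        using elim by (simp add: g_def)
    qed
  qed
  have S_le: "AE x in M. S n x \<le> exp n" for n
  proof -
    have "AE x in M. \<forall>i\<in>{1..n}. g i x \<le> 1"
      using g_le by (intro AE_finite_allI) auto
    then show ?thesis
    proof eventually_elim
      case (elim x)
      then have "(\<Sum>i=1..n. g i x) \<le> (\<Sum>i=1..n. 1)"
        by (intro sum_mono) auto
      then show ?case
        by (simp add: S_def)
    qed
  qed
  have iS: "integrable M (S n)" for n
    using S_le[of n] measurable_F_M[OF S_F]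
    by (intro integrable_const_bound[of "S n" "exp n"]) (auto simp: S_def)
  have "1 / \<delta> * prob {x \<in> space M. \<exists>n. 1 / \<delta> \<le> S n x} \<le> expectation (S 0)"
  proof (rule ville_maximal_inequality[OF S_F iS])
    fix n A assume A: "A \<in> sets (F n)"
    interpret finite_measure_subalgebra M "F n"
      by (rule finite_measure_subalgebra_F)
    let ?G = "\<lambda>x. indicator A x * S n x"
    have "(\<integral>x\<in>A. S (Suc n) x \<partial>M) = (\<integral>x. ?G x * exp (g (Suc n) x) \<partial>M)"
      by (simp add: set_lebesgue_integral_def S_def exp_add mult.assoc)
    also have "\<dots> \<le> (\<integral>x. ?G x \<partial>M)"
      unfolding g_def
    proof (rule empirical_bernstein_step)
      show "?G \<in> borel_measurable (F n)"
        using A S_F by measurable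
      show "AE x in M. ?G x \<in> {0..exp n}"
        using S_le[of n] by eventually_elim (auto simp: S_def indicator_def)
    qed (use Y_F[of "Suc n"] Y[of "Suc n"] mean[of "Suc n"] c[of "Suc n"] l[of "Suc n"]
        pred[of "Suc n"] in \<open>auto intro: measurable_F_M\<close>)
    finally show "(\<integral>x\<in>A. S (Suc n) x \<partial>M) \<le> (\<integral>x\<in>A. S n x \<partial>M)"
      by (simp add: set_lebesgue_integral_def)
  qed (auto simp: S_def)
  moreover have "expectation (S 0) = 1"
    by (simp add: S_def[abs_def] prob_space)
  ultimately have "prob {x \<in> space M. \<exists>n. 1 / \<delta> \<le> S n x} \<le> \<delta>"
    using \<delta> by (simp add: pos_divide_le_eq)
  moreover have "1 / \<delta> \<le> S n x \<longleftrightarrow> ln (1 / \<delta>) + (\<Sum>i=1..n. psi_E (l i x) * (Y i x - c i x)\<^sup>2)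
      \<le> (\<Sum>i=1..n. l i x * (Y i x - m i x))" for n x
    unfolding S_def g_def using \<delta> by (subst ln_le_cancel_iff[symmetric]) (auto simp: sum_subtractf)
  ultimately show ?thesis
    by simp
qed

text \<open>
  The lower tail is the upper tail of the reflected process \<open>1 - Y\<close>: reflection stays within \<open>[0, 1]\<close>,
  negates the deviations from the conditional means and preserves the squares \<open>(Y - c)\<^sup>2\<close>.
\<close>

lemma empirical_bernstein_two_sided:
  fixes Y m c l :: "nat \<Rightarrow> 'a \<Rightarrow> real"
  assumes Y_F: "\<And>i. i \<ge> 1 \<Longrightarrow> Y i \<in> borel_measurable (F i)"
    and Y: "\<And>i. i \<ge> 1 \<Longrightarrow> AE x in M. Y i x \<in> {0..1}"
    and mean: "\<And>i. i \<ge> 1 \<Longrightarrow> AE x in M. real_cond_exp M (F (i - 1)) (Y i) x = m i x"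
    and m_F: "predictable F m"
    and c_F: "predictable F c" and c: "\<And>i. i \<ge> 1 \<Longrightarrow> AE x in M. c i x \<in> {0..1}"
    and l_F: "predictable F l" and l: "\<And>i. i \<ge> 1 \<Longrightarrow> AE x in M. l i x \<in> {0..<1}"
    and \<delta>: "0 < \<delta>"
  shows "1 - 2 * \<delta> \<le> prob {x \<in> space M. \<forall>t. \<bar>\<Sum>i=1..t. l i x * (Y i x - m i x)\<bar>
      < ln (1 / \<delta>) + (\<Sum>i=1..t. psi_E (l i x) * (Y i x - c i x)\<^sup>2)}"
    (is "_ \<le> prob ?good")
proof -
  let ?dev = "\<lambda>t x. \<Sum>i=1..t. l i x * (Y i x - m i x)"
  let ?bd = "\<lambda>t x. ln (1 / \<delta>) + (\<Sum>i=1..t. psi_E (l i x) * (Y i x - c i x)\<^sup>2)"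
  define U where "U = {x \<in> space M. \<exists>t. ?bd t x \<le> ?dev t x}"
  define L where "L = {x \<in> space M. \<exists>t. ?bd t x \<le> - ?dev t x}"
  have pred: "m i \<in> borel_measurable (F (i - 1))" "c i \<in> borel_measurable (F (i - 1))"
    "l i \<in> borel_measurable (F (i - 1))" if "i \<ge> 1" for i
    using m_F c_F l_F that by (auto simp: predictable_def)
  have "Y i \<in> borel_measurable M" "m i \<in> borel_measurable M"
    "c i \<in> borel_measurable M" "l i \<in> borel_measurable M" if "i \<ge> 1" for i
    using pred[OF that] Y_F[OF that] by (auto intro: measurable_F_M)
  then have [measurable]: "?dev t \<in> borel_measurable M" "?bd t \<in> borel_measurable M" for t
    by (auto intro!: borel_measurable_sum borel_measurable_add borel_measurable_times
        borel_measurable_power borel_measurable_diff measurable_compose[OF _ borel_measurable_psi_E])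
  have [measurable]: "U \<in> sets M" "L \<in> sets M"
    unfolding U_def L_def by measurable
  have "prob U \<le> \<delta>"
    unfolding U_def by (rule empirical_bernstein_upper[OF Y_F Y mean m_F c_F c l_F l \<delta>])
  moreover have "prob L \<le> \<delta>"
  proof -
    have "prob {x \<in> space M. \<exists>t. ln (1 / \<delta>)
          + (\<Sum>i=1..t. psi_E (l i x) * ((1 - Y i x) - (1 - c i x))\<^sup>2)
        \<le> (\<Sum>i=1..t. l i x * ((1 - Y i x) - (1 - m i x)))} \<le> \<delta>"
    proof (rule empirical_bernstein_upper[OF _ _ _ _ _ _ l_F l \<delta>])
      fix i :: nat assume i: "i \<ge> 1"
      interpret finite_measure_subalgebra M "F (i - 1)"
        by (rule finite_measure_subalgebra_F)
      have "integrable M (Y i)"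
        using Y[OF i] measurable_F_M[OF Y_F[OF i]] by (intro integrable_const_bound[of _ 1]) auto
      then have "AE x in M. real_cond_exp M (F (i - 1)) (\<lambda>x. 1 - Y i x) x
          = real_cond_exp M (F (i - 1)) (\<lambda>x. 1) x - real_cond_exp M (F (i - 1)) (Y i) x"
        by (intro real_cond_exp_diff) auto
      moreover have "AE x in M. real_cond_exp M (F (i - 1)) (\<lambda>x. 1) x = 1"
        by (intro real_cond_exp_F_meas) auto
      ultimately show "AE x in M. real_cond_exp M (F (i - 1)) (\<lambda>x. 1 - Y i x) x = 1 - m i x"
        using mean[OF i] by eventually_elim simp
    qed (use Y_F Y c pred in \<open>auto simp: predictable_def\<close>)
    moreover have "((1 - Y i x) - (1 - c i x))\<^sup>2 = (Y i x - c i x)\<^sup>2" for i x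
      by (simp add: power2_commute)
    moreover have "(\<Sum>i=1..t. l i x * ((1 - Y i x) - (1 - m i x))) = - ?dev t x" for t x
      by (simp add: algebra_simps flip: sum_negf)
    ultimately show ?thesis
      by (simp add: L_def)
  qed
  ultimately have "prob (U \<union> L) \<le> 2 * \<delta>"
    using measure_Un_le[of U M L] by simp
  moreover have "?good = space M - (U \<union> L)"
    by (auto simp: U_def L_def abs_less_iff not_le) (smt (verit))+
  ultimately show ?thesis
    using prob_compl[of "U \<union> L"] by simp
qed

end

section \<open>Confidence sequence for the variance\<close>

lemma (in prob_space) filtered_prob_space_canonical:
  assumes "\<And>t. t \<ge> 1 \<Longrightarrow> X t \<in> borel_measurable M"
  shows "filtered_prob_space M (canonical_filtration M X)"
proof -
  define G where "G t = (\<Union>i\<in>{1..t}. (\<lambda>B. X i -` B \<inter> space M) ` sets borel)" for t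
  have F: "canonical_filtration M X t = sigma (space M) (G t)" for t
    unfolding canonical_filtration_def G_def by (intro arg_cong2[where f = sigma]) blast+
  have G_Pow: "G t \<subseteq> Pow (space M)" for t
    by (auto simp: G_def)
  have G_M: "G t \<subseteq> sets M" for t
    unfolding G_def using measurable_sets[OF assms] by auto
  show ?thesis
  proof
    show "space (canonical_filtration M X t) = space M" for t
      unfolding F by (rule space_measure_of[OF G_Pow])
    show "sets (canonical_filtration M X s) \<subseteq> sets (canonical_filtration M X t)" if "s \<le> t" for s t
      unfolding F sets_measure_of[OF G_Pow]
      unfolding G_def by (intro sigma_sets_mono' UN_mono) (use that in auto)
    show "sets (canonical_filtration M X t) \<subseteq> sets M" for t
      unfolding F sets_measure_of[OF G_Pow] by (rule sets.sigma_sets_subset[OF G_M])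
  qed
qed

lemma canonical_filtration_adapted:
  assumes "1 \<le> t"
  shows "X t \<in> borel_measurable (canonical_filtration M X t)"
proof (rule measurableI)
  fix B :: "real set" assume B: "B \<in> sets borel"
  have "X t -` B \<inter> space M \<in> sigma_sets (space M)
      {X i -` B \<inter> space M |i B. i \<in> {1..t} \<and> B \<in> sets borel}"
    using assms B by (intro sigma_sets.Basic CollectI exI[of _ t] exI[of _ B]) simp
  moreover have "{X i -` B \<inter> space M |i B. i \<in> {1..t} \<and> B \<in> sets borel} \<subseteq> Pow (space M)"
    by blast
  ultimately show "X t -` B \<inter> space (canonical_filtration M X t) \<in> sets (canonical_filtration M X t)"
    unfolding canonical_filtration_def by (simp only: sets_measure_of space_measure_of)
qed simp

text \<open>
  Clearing the denominator is legitimate outside the degenerate case because the sum of the weights is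
  then positive. What remains is a bound on a sum of deviations of \<open>(X i - muh i)\<^sup>2\<close> from
  \<open>v + (muh i - \<mu>)\<^sup>2\<close>, the conditional mean if \<open>v\<close> is the conditional variance.
\<close>

lemma mem_variance_interval_iff:
  fixes lam X muh sigh :: "nat \<Rightarrow> 'a \<Rightarrow> real"
  assumes nonneg: "\<And>i. 1 \<le> i \<Longrightarrow> 0 \<le> lam i \<omega>"
  shows "v \<in> variance_interval \<alpha> \<mu> X lam muh sigh t \<omega> \<longleftrightarrow>
    (\<Sum>i=1..t. lam i \<omega>) = 0 \<or>
    \<bar>\<Sum>i=1..t. lam i \<omega> * ((X i \<omega> - muh i \<omega>)\<^sup>2 - (v + (muh i \<omega> - \<mu>)\<^sup>2))\<bar>
      < ln (1 / (\<alpha> / 2)) + (\<Sum>i=1..t. psi_E (lam i \<omega>) * ((X i \<omega> - muh i \<omega>)\<^sup>2 - (sigh i \<omega>)\<^sup>2)\<^sup>2)"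
proof (cases "(\<Sum>i=1..t. lam i \<omega>) = 0")
  case False
  define \<Lambda> where "\<Lambda> = (\<Sum>i=1..t. lam i \<omega>)"
  define r where "r = ln (1 / (\<alpha> / 2))
    + (\<Sum>i=1..t. psi_E (lam i \<omega>) * ((X i \<omega> - muh i \<omega>)\<^sup>2 - (sigh i \<omega>)\<^sup>2)\<^sup>2)"
  define d where "d = (\<Sum>i=1..t. lam i \<omega> * (X i \<omega> - muh i \<omega>)\<^sup>2)"
  define e where "e = (\<Sum>i=1..t. lam i \<omega> * (muh i \<omega> - \<mu>)\<^sup>2)"
  have "0 < \<Lambda>"
    using False nonneg sum_nonneg[of "{1..t}" "\<lambda>i. lam i \<omega>"] by (auto simp: \<Lambda>_def less_le)
  then have "(d - e - r) / \<Lambda> < v \<longleftrightarrow> d - e - r < v * \<Lambda>"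
    and "v < (d - e + r) / \<Lambda> \<longleftrightarrow> v * \<Lambda> < d - e + r"
    by (simp_all only: pos_divide_less_eq pos_less_divide_eq)
  moreover have "\<bar>d - e - v * \<Lambda>\<bar> < r \<longleftrightarrow> d - e - r < v * \<Lambda> \<and> v * \<Lambda> < d - e + r"
    by linarith
  moreover have "(\<Sum>i=1..t. lam i \<omega> * ((X i \<omega> - muh i \<omega>)\<^sup>2 - (v + (muh i \<omega> - \<mu>)\<^sup>2))) = d - e - v * \<Lambda>"
    by (simp add: d_def e_def \<Lambda>_def algebra_simps sum.distrib sum_subtractf sum_distrib_left)
  moreover have "v \<in> variance_interval \<alpha> \<mu> X lam muh sigh t \<omega> \<longleftrightarrow>
      (d - e - r) / \<Lambda> < v \<and> v < (d - e + r) / \<Lambda>"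
    using False by (simp add: variance_interval_def D_stat_def E_stat_def R_stat_def
        d_def e_def r_def \<Lambda>_def add_divide_distrib diff_divide_distrib)
  ultimately have "v \<in> variance_interval \<alpha> \<mu> X lam muh sigh t \<omega> \<longleftrightarrow>
      \<bar>\<Sum>i=1..t. lam i \<omega> * ((X i \<omega> - muh i \<omega>)\<^sup>2 - (v + (muh i \<omega> - \<mu>)\<^sup>2))\<bar> < r"
    by simp
  then show ?thesis
    using False by (simp add: r_def)
qed (simp add: variance_interval_def)

theorem corollary4p2:
  fixes M :: "'a measure"
    and X lam muh sigh :: "nat \<Rightarrow> 'a \<Rightarrow> real"
    and \<mu> \<sigma> \<alpha> :: real
  assumes "prob_space M"
    and "\<And>t. t \<ge> 1 \<Longrightarrow> X t \<in> borel_measurable M"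
    and "\<And>t. t \<ge> 1 \<Longrightarrow> AE \<omega> in M. X t \<omega> \<in> {0..1}"
    and "\<And>t. t \<ge> 1 \<Longrightarrow>
           AE \<omega> in M. real_cond_exp M (canonical_filtration M X (t - 1)) (X t) \<omega> = \<mu>"
    and "\<And>t. t \<ge> 1 \<Longrightarrow>
           AE \<omega> in M. real_cond_var M (canonical_filtration M X (t - 1)) (X t) \<omega> = \<sigma>\<^sup>2"
    and "\<alpha> \<in> {0<..<1}"
    and "predictable (canonical_filtration M X) lam"
    and "\<And>i. i \<ge> 1 \<Longrightarrow> AE \<omega> in M. lam i \<omega> \<in> {0..<1}"
    and "predictable (canonical_filtration M X) muh"
    and "\<And>i. i \<ge> 1 \<Longrightarrow> AE \<omega> in M. muh i \<omega> \<in> {0..1}"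
    and "predictable (canonical_filtration M X) sigh"
    and "\<And>i. i \<ge> 1 \<Longrightarrow> AE \<omega> in M. sigh i \<omega> \<in> {0..1}"
  shows "confidence_sequence M \<alpha> (\<sigma>\<^sup>2) (variance_interval \<alpha> \<mu> X lam muh sigh)"
proof -
  interpret prob_space M by fact
  let ?F = "canonical_filtration M X"
  interpret filtered_prob_space M ?F
    using assms(2) by (rule filtered_prob_space_canonical)
  define Y where "Y i \<omega> = (X i \<omega> - muh i \<omega>)\<^sup>2" for i \<omega>
  define m where "m i \<omega> = \<sigma>\<^sup>2 + (muh i \<omega> - \<mu>)\<^sup>2" for i \<omega>
  have pred: "lam i \<in> borel_measurable (?F (i - 1))" "muh i \<in> borel_measurable (?F (i - 1))"
    "sigh i \<in> borel_measurable (?F (i - 1))" if "i \<ge> 1" for i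
    using assms that by (auto simp: predictable_def)
  have Y_F: "Y i \<in> borel_measurable (?F i)" if "i \<ge> 1" for i
  proof -
    have [measurable]: "X i \<in> borel_measurable (?F i)" "muh i \<in> borel_measurable (?F i)"
      using canonical_filtration_adapted[OF that] pred(2)[OF that, THEN measurable_F_mono] by auto
    show ?thesis
      by (simp add: Y_def[abs_def])
  qed
  have Y01: "AE \<omega> in M. Y i \<omega> \<in> {0..1}" if "i \<ge> 1" for i
    using assms(3)[OF that] assms(10)[OF that]
  proof eventually_elim
    case (elim \<omega>)
    then have "\<bar>X i \<omega> - muh i \<omega>\<bar> \<le> 1" by auto
    then show ?case by (simp add: Y_def abs_square_le_1)
  qed
  have Y_mean: "AE \<omega> in M. real_cond_exp M (?F (i - 1)) (Y i) \<omega> = m i \<omega>" if i: "i \<ge> 1" for i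
  proof -
    interpret finite_measure_subalgebra M "?F (i - 1)"
      by (rule finite_measure_subalgebra_F)
    have "AE \<omega> in M. real_cond_exp M (?F (i - 1)) (Y i) \<omega>
        = real_cond_var M (?F (i - 1)) (X i) \<omega> + (muh i \<omega> - \<mu>)\<^sup>2"
      unfolding Y_def
      by (rule real_cond_exp_square_deviation[of _ 1])
        (use assms(2,3,4,10)[OF i] pred(2)[OF i] in auto)
    then show ?thesis
      using assms(5)[OF i] by eventually_elim (simp add: m_def)
  qed
  let ?good = "{\<omega> \<in> space M. \<forall>t. \<bar>\<Sum>i=1..t. lam i \<omega> * (Y i \<omega> - m i \<omega>)\<bar>
      < ln (1 / (\<alpha> / 2)) + (\<Sum>i=1..t. psi_E (lam i \<omega>) * (Y i \<omega> - (sigh i \<omega>)\<^sup>2)\<^sup>2)}"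
  let ?cover = "{\<omega> \<in> space M. \<forall>t\<ge>1. \<sigma>\<^sup>2 \<in> variance_interval \<alpha> \<mu> X lam muh sigh t \<omega>}"
  have "1 - 2 * (\<alpha> / 2) \<le> prob ?good"
  proof (rule empirical_bernstein_two_sided[OF Y_F Y01 Y_mean])
    show "predictable ?F m" "predictable ?F (\<lambda>i \<omega>. (sigh i \<omega>)\<^sup>2)"
      using pred by (auto simp: predictable_def m_def[abs_def])
    show "AE \<omega> in M. (sigh i \<omega>)\<^sup>2 \<in> {0..1}" if "i \<ge> 1" for i
      using assms(12)[OF that] by eventually_elim (auto simp: power_le_one)
  qed (use assms in auto)
  \<comment> \<open>The inclusion holds only almost surely, as the weights are nonnegative only almost surely.\<close>
  also have "prob ?good \<le> prob ?cover"
  proof (rule finite_measure_mono_AE)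
    have "AE \<omega> in M. \<forall>i\<in>{1..}. lam i \<omega> \<in> {0..<1}"
      using assms(8) by (intro AE_ball_countable') auto
    then show "AE \<omega> in M. \<omega> \<in> ?good \<longrightarrow> \<omega> \<in> ?cover"
      by eventually_elim (auto simp: mem_variance_interval_iff Y_def m_def)
    have meas: "X i \<in> borel_measurable M" "lam i \<in> borel_measurable M"
      "muh i \<in> borel_measurable M" "sigh i \<in> borel_measurable M" if "i \<in> {1..t}" for i t
      using that pred[of i] assms(2)[of i] by (auto intro: measurable_F_M)
    have "{\<omega> \<in> space M. \<sigma>\<^sup>2 \<in> variance_interval \<alpha> \<mu> X lam muh sigh t \<omega>} \<in> sets M" for t
    proof -
      note borel_measurable_intros = borel_measurable_sum borel_measurable_add
        borel_measurable_times borel_measurable_power borel_measurable_diff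
        borel_measurable_divide borel_measurable_const
        measurable_compose[OF _ borel_measurable_psi_E] meas
      have [measurable]: "(\<lambda>\<omega>. \<Sum>i=1..t. lam i \<omega>) \<in> borel_measurable M"
        "D_stat X lam muh t \<in> borel_measurable M"
        "E_stat \<mu> lam muh t \<in> borel_measurable M"
        "R_stat X lam muh sigh (\<alpha> / 2) t \<in> borel_measurable M"
        unfolding D_stat_def[abs_def] E_stat_def[abs_def] R_stat_def[abs_def]
        by (intro borel_measurable_intros; assumption)+
      have "(\<sigma>\<^sup>2 \<in> variance_interval \<alpha> \<mu> X lam muh sigh t \<omega>) \<longleftrightarrow> (\<Sum>i=1..t. lam i \<omega>) = 0 \<or>
          D_stat X lam muh t \<omega> - E_stat \<mu> lam muh t \<omega> - R_stat X lam muh sigh (\<alpha> / 2) t \<omega> < \<sigma>\<^sup>2 \<and>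
          \<sigma>\<^sup>2 < D_stat X lam muh t \<omega> - E_stat \<mu> lam muh t \<omega> + R_stat X lam muh sigh (\<alpha> / 2) t \<omega>" for \<omega>
        by (simp add: variance_interval_def)
      then show ?thesis
        by (simp only:) measurable
    qed
    then show "?cover \<in> sets M"
      by measurable
  qed
  finally show ?thesis
    by (simp add: confidence_sequence_def)
qed

end
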